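(* Let $p,q\ge 1$ with $\frac1p+\frac1q=1$, so that $\ell_q$ is the dual norm of $\ell_p$ (the cases $p=1,q=\infty$ and $p=\infty,q=1$ included), and let $(\hat y,\hat\eta)\in\mathbb{R}^n\times\mathbb{R}$ be the incumbent point. Then the separation problem $$d^*_{\ell_p}(\hat y,\hat\eta)=\max_{(\pi,\pi_0)\in\Pi}\ \frac{\pi^\top(b-B\hat y)+\pi_0(f^\top\hat y-\hat\eta)}{\|(\pi^\top B-\pi_0f^\top,\ \pi_0)\|_p}$$ is equivalent to the following Lagrangian dual problem, in which $(y,x,\eta)$ are the variables: $$\begin{aligned}\min\quad & \|(y-\hat y,\ \eta-\hat\eta)\|_q\\ \text{s.t.}\quad & \eta\ge c^\top x+f^\top y,\\ & Ax\ge b-By,\\ & x\ge 0,\ \ \eta\ge\hat\eta.\end{aligned}$$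
   Context: Data: $f\in\mathbb{R}^n$, $c\in\mathbb{R}^{n'}$, $b\in\mathbb{R}^m$, $A\in\mathbb{R}^{m\times n'}$, $B\in\mathbb{R}^{m\times n}$, $Y\subset\mathbb{Z}^n$. The underlying problem is the mixed-integer linear program $\min\{c^\top x+f^\top y: Ax+By\ge b,\ x\ge0,\ y\in Y\}$, about which it is assumed only that it is a bounded mixed-integer linear program. The cone of dual solutions is $\Pi=\{(\pi,\pi_0)\in\mathbb{R}^m\times\mathbb{R}:\pi^\top A\le\pi_0c^\top,\ \pi\ge0,\ \pi_0\ge0\}$. In the Lagrangian dual problem, $x\in\mathbb{R}^{n'}$, $y\in\mathbb{R}^n$ and $\eta\in\mathbb{R}$. *)

theory Defs
  imports "HOL-Analysis.Analysis"
begin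

text \<open>
  On \<^typ>\<open>(real^'n) \<times> real\<close> the inner products with the basis vectors are the \<open>n + 1\<close> coordinates,
  so this is the usual \<open>\<ell>\<^sub>p\<close> norm of the concatenated vector, for \<open>1 \<le> p \<le> \<infinity>\<close>.
\<close>

definition lp_norm :: "ereal \<Rightarrow> 'a::euclidean_space \<Rightarrow> real" where
  "lp_norm p v =
    (if p = \<infinity> then infnorm v
     else (\<Sum>i\<in>Basis. \<bar>v \<bullet> i\<bar> powr real_of_ereal p) powr (1 / real_of_ereal p))"

definition integer_vectors :: "(real^'n) set" where
  "integer_vectors = {y. \<forall>i. y $ i \<in> \<int>}"

definition milp_feasible ::
    "real^'k^'m \<Rightarrow> real^'n^'m \<Rightarrow> real^'m \<Rightarrow> (real^'n) set \<Rightarrow> ((real^'k) \<times> (real^'n)) set" where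
  "milp_feasible A B b Y = {(x, y). b \<le> A *v x + B *v y \<and> 0 \<le> x \<and> y \<in> Y}"

text \<open>Boundedness refers to the objective; neither feasibility nor a bounded feasible set is required.\<close>

definition bounded_milp ::
    "real^'k^'m \<Rightarrow> real^'n^'m \<Rightarrow> real^'m \<Rightarrow> real^'k \<Rightarrow> real^'n \<Rightarrow> (real^'n) set \<Rightarrow> bool" where
  "bounded_milp A B b c f Y \<longleftrightarrow>
    Y \<subseteq> integer_vectors \<and> bdd_below ((\<lambda>(x, y). c \<bullet> x + f \<bullet> y) ` milp_feasible A B b Y)"

definition dual_cone :: "real^'k^'m \<Rightarrow> real^'k \<Rightarrow> ((real^'m) \<times> real) set" where
  "dual_cone A c = {(\<pi>, \<pi>0). \<pi> v* A \<le> \<pi>0 *\<^sub>R c \<and> 0 \<le> \<pi> \<and> 0 \<le> \<pi>0}"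

definition cut_violation ::
    "real^'n^'m \<Rightarrow> real^'m \<Rightarrow> real^'n \<Rightarrow> real^'n \<Rightarrow> real \<Rightarrow> (real^'m) \<times> real \<Rightarrow> real" where
  "cut_violation B b f yh \<eta>h = (\<lambda>(\<pi>, \<pi>0). \<pi> \<bullet> (b - B *v yh) + \<pi>0 * (f \<bullet> yh - \<eta>h))"

definition cut_norm ::
    "ereal \<Rightarrow> real^'n^'m \<Rightarrow> real^'n \<Rightarrow> (real^'m) \<times> real \<Rightarrow> real" where
  "cut_norm p B f = (\<lambda>(\<pi>, \<pi>0). lp_norm p (\<pi> v* B - \<pi>0 *\<^sub>R f, \<pi>0))"

text \<open>
  The cone contains the origin, and possibly other points, at which the denominator vanishes.
  The division is therefore that of \<^typ>\<open>ereal\<close>, where \<open>t / 0\<close> is \<open>\<infinity>\<close> for \<open>t > 0\<close>,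
  \<open>-\<infinity>\<close> for \<open>t < 0\<close> and \<open>0\<close> for \<open>t = 0\<close>.
\<close>

definition cut_depth ::
    "ereal \<Rightarrow> real^'n^'m \<Rightarrow> real^'m \<Rightarrow> real^'n \<Rightarrow> real^'n \<Rightarrow> real \<Rightarrow> (real^'m) \<times> real \<Rightarrow> ereal" where
  "cut_depth p B b f yh \<eta>h s = ereal (cut_violation B b f yh \<eta>h s) / ereal (cut_norm p B f s)"

definition separation_value ::
    "ereal \<Rightarrow> real^'k^'m \<Rightarrow> real^'n^'m \<Rightarrow> real^'m \<Rightarrow> real^'k \<Rightarrow> real^'n \<Rightarrow> real^'n \<Rightarrow> real \<Rightarrow> ereal" where
  "separation_value p A B b c f yh \<eta>h = (SUP s\<in>dual_cone A c. cut_depth p B b f yh \<eta>h s)"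

definition lagrangian_feasible ::
    "real^'k^'m \<Rightarrow> real^'n^'m \<Rightarrow> real^'m \<Rightarrow> real^'k \<Rightarrow> real^'n \<Rightarrow> real
      \<Rightarrow> ((real^'n) \<times> (real^'k) \<times> real) set" where
  "lagrangian_feasible A B b c f \<eta>h =
    {(y, x, \<eta>). c \<bullet> x + f \<bullet> y \<le> \<eta> \<and> b - B *v y \<le> A *v x \<and> 0 \<le> x \<and> \<eta>h \<le> \<eta>}"

definition lagrangian_objective ::
    "ereal \<Rightarrow> real^'n \<Rightarrow> real \<Rightarrow> (real^'n) \<times> (real^'k) \<times> real \<Rightarrow> real" where
  "lagrangian_objective q yh \<eta>h = (\<lambda>(y, x, \<eta>). lp_norm q (y - yh, \<eta> - \<eta>h))"

definition lagrangian_value ::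
    "ereal \<Rightarrow> real^'k^'m \<Rightarrow> real^'n^'m \<Rightarrow> real^'m \<Rightarrow> real^'k \<Rightarrow> real^'n \<Rightarrow> real^'n \<Rightarrow> real \<Rightarrow> ereal" where
  "lagrangian_value q A B b c f yh \<eta>h =
    (INF z\<in>lagrangian_feasible A B b c f \<eta>h. ereal (lagrangian_objective q yh \<eta>h z))"

end

theory Submission
  imports Defs
begin

text \<open>
  Weak duality is Hoelder's inequality applied to the pairing of a cut with the displacement from
  the incumbent. For the converse, let \<open>d > 0\<close> be the \<open>\<ell>\<^sub>q\<close>-distance from the incumbent to the
  projection of the feasible set to the \<open>(y, \<eta>)\<close>-space, which is a closed polyhedron. A hyperplane
  separates this projection from the open \<open>\<ell>\<^sub>q\<close>-ball of radius \<open>d\<close>, and since \<open>\<ell>\<^sub>p\<close> is the dual norm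
  it does so with margin \<open>d\<close> times the \<open>\<ell>\<^sub>p\<close>-norm of its normal. By Farkas' lemma the hyperplane
  is dominated by a cut with multipliers in the dual cone, whose depth is therefore at least \<open>d\<close>.
  If the Lagrangian problem is infeasible, Farkas' lemma yields a multiplier with vanishing norm and
  positive violation. The constraint \<open>\<eta> \<ge> \<eta>h\<close> needs no multiplier: raising \<open>\<eta>\<close> to \<open>\<eta>h\<close> keeps a
  point feasible and does not increase its distance to the incumbent.
\<close>

section \<open>Closedness of finitely generated cones and Farkas' lemma\<close>

text \<open>
  A conic version of Caratheodory's theorem: if \<open>L\<close> is not injective on the span of a face of the
  orthant, moving along the kernel shows that the image of the face is the union of the images of
  its facets.
\<close>

lemma linear_image_nonneg_face_closed:
  fixes L :: "'a::ordered_euclidean_space \<Rightarrow> 'b::euclidean_space"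
  assumes L: "linear L" and "finite I"
  shows "closed (L ` {x. 0 \<le> x \<and> (\<forall>i\<in>Basis - I. x \<bullet> i = 0)})"
  using \<open>finite I\<close>
proof (induction I rule: finite_psubset_induct)
  case (psubset I)
  define F where "F J = {x::'a. 0 \<le> x \<and> (\<forall>i\<in>Basis - J. x \<bullet> i = 0)}" for J
  define V where "V = {x::'a. \<forall>i\<in>Basis - I. x \<bullet> i = 0}"
  have V: "subspace V"
    unfolding V_def subspace_def by (auto simp: inner_simps)
  have F_eq: "F J = {x. (\<forall>i\<in>Basis. 0 \<le> x \<bullet> i) \<and> (\<forall>i\<in>Basis - J. x \<bullet> i = 0)}" for J
    unfolding F_def by (subst eucl_le) auto
  have "closed (L ` F I)"
  proof (cases "inj_on L V")
    case True
    then obtain g where g: "linear g" "\<And>v. v \<in> V \<Longrightarrow> g (L v) = v"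
      using linear_exists_left_inverse_on[OF L V] by metis
    have "F I \<subseteq> V"
      by (auto simp: F_def V_def)
    \<comment> \<open>The left inverse \<open>g\<close> turns membership in the image into two
      closed conditions: \<open>L (g y) = y\<close>, and \<open>g y\<close> lies in the
      face.\<close>
    then have eq: "L ` F I = {y. L (g y) = y} \<inter> {y. g y \<in> F I}"
      using g(2) by (force simp: image_iff)
    have "F I = (\<Inter>i\<in>Basis. {x. 0 \<le> x \<bullet> i}) \<inter> (\<Inter>i\<in>Basis - I. {x. x \<bullet> i = 0})"
      unfolding F_eq by blast
    moreover have "closed {x::'a. 0 \<le> x \<bullet> i}" "closed {x::'a. x \<bullet> i = 0}" for i
      by (auto intro!: closed_Collect_le closed_Collect_eq continuous_intros)
    ultimately have "closed (F I)"
      by (auto intro!: closed_Int closed_INT)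
    then have "closed (g -` F I)"
      using g(1) by (intro continuous_closed_vimage linear_continuous_at) (auto simp: linear_conv_bounded_linear)
    moreover have "closed {y. L (g y) = y}"
      using linear_compose[OF g(1) L]
      by (intro closed_Collect_eq) (auto simp: linear_conv_bounded_linear o_def intro: linear_continuous_on)
    ultimately show ?thesis
      unfolding eq by (auto simp: vimage_def)
  next
    case False
    then obtain w where w: "w \<in> V" "w \<noteq> 0" "L w = 0"
      using linear_inj_on_iff_eq_0[OF L V] by auto
    \<comment> \<open>The sign is chosen so that \<open>v\<close> has a positive coordinate;
      otherwise no coordinate would limit the step taken along \<open>- v\<close> below.\<close>
    define v where "v = (if \<exists>i\<in>Basis. 0 < w \<bullet> i then w else - w)"
    have "\<exists>i\<in>Basis. w \<bullet> i \<noteq> 0"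
      using w(2) euclidean_all_zero_iff by blast
    then have v: "\<exists>i\<in>Basis. 0 < v \<bullet> i"
      unfolding v_def by (auto simp: neq_iff)
    have vV: "v \<in> V" "L v = 0"
      using w V L by (simp_all add: v_def linear_neg subspace_neg)
    define T where "T = {i\<in>Basis. 0 < v \<bullet> i}"
    have T: "finite T" "T \<noteq> {}"
      using v by (auto simp: T_def)
    have T_I: "T \<subseteq> I \<inter> Basis"
      proof
      fix i assume "i \<in> T"
      then have "i \<in> Basis" "v \<bullet> i \<noteq> 0"
        by (auto simp: T_def)
      then show "i \<in> I \<inter> Basis"
        using vV(1) unfolding V_def by blast
    qed
    have "L ` F I \<subseteq> (\<Union>i\<in>I \<inter> Basis. L ` F (I - {i}))"
    proof clarify
      fix x assume x: "x \<in> F I"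
      \<comment> \<open>Ratio test: \<open>r\<close> is the largest step along \<open>- v\<close>
        that stays in the orthant. A coordinate \<open>j\<close> attaining the minimum drops to
        zero, so the point lands in a facet with the same image under \<open>L\<close>.\<close>
      define r where "r = Min ((\<lambda>i. (x \<bullet> i) / (v \<bullet> i)) ` T)"
      obtain j where j: "j \<in> T" "r = (x \<bullet> j) / (v \<bullet> j)"
        using Min_in[of "(\<lambda>i. (x \<bullet> i) / (v \<bullet> i)) ` T"] T unfolding r_def by blast
      have r_le: "r \<le> (x \<bullet> i) / (v \<bullet> i)" if "i \<in> T" for i
        using T that unfolding r_def by (intro Min_le) auto
      have r0: "0 \<le> r"
        using j x by (auto simp: T_def F_eq)
      let ?y = "x - r *\<^sub>R v"
      have "0 \<le> ?y \<bullet> i" if i: "i \<in> Basis" for i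
      proof (cases "0 < v \<bullet> i")
        case True
        then have "r * (v \<bullet> i) \<le> x \<bullet> i"
          using r_le[of i] i by (simp add: T_def pos_le_divide_eq)
        then show ?thesis by (simp add: inner_simps)
      next
        case False
        then have "r * (v \<bullet> i) \<le> 0"
          using r0 by (simp add: mult_nonneg_nonpos)
        moreover have "0 \<le> x \<bullet> i"
          using x i by (simp add: F_eq)
        ultimately show ?thesis by (simp add: inner_simps)
      qed
      moreover have "?y \<bullet> j = 0"
        using j by (simp add: inner_simps T_def)
      moreover have "?y \<bullet> i = 0" if "i \<in> Basis - I" for i
      proof -
        have "x \<bullet> i = 0" "v \<bullet> i = 0"
          using x vV(1) that by (simp_all add: F_def V_def)
        then show ?thesis by (simp add: inner_simps)
      qed
      ultimately have "?y \<in> F (I - {j})"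
        unfolding F_eq by blast
      moreover have "L ?y = L x"
        using vV(2) by (simp add: linear_diff[OF L] linear_scale[OF L])
      ultimately show "L x \<in> (\<Union>i\<in>I \<inter> Basis. L ` F (I - {i}))"
        using j(1) T_I by (metis UN_I image_eqI subsetD)
    qed
    moreover have "(\<Union>i\<in>I \<inter> Basis. L ` F (I - {i})) \<subseteq> L ` F I"
      by (auto simp: F_eq)
    ultimately have "L ` F I = (\<Union>i\<in>I \<inter> Basis. L ` F (I - {i}))"
      by blast
    moreover have "closed (L ` F (I - {i}))" if "i \<in> I \<inter> Basis" for i
      using psubset.IH[of "I - {i}"] that unfolding F_def by blast
    ultimately show ?thesis by (simp add: closed_UN)
  qed
  then show ?case unfolding F_def .
qed

lemma closed_linear_image_nonneg:
  fixes L :: "'a::ordered_euclidean_space \<Rightarrow> 'b::euclidean_space"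
  assumes "linear L"
  shows "closed (L ` {0..})"
  using linear_image_nonneg_face_closed[OF assms finite_Basis] by (simp add: atLeast_def)

text \<open>A hyperplane strictly separates \<open>z\<close> from the image of the orthant, which is
  a closed convex cone. The functional must be nonnegative on the cone, since a negative value could
  be scaled down to the separating level; so it violates \<open>nonneg\<close> at
  \<open>z\<close>.\<close>

lemma farkas:
  fixes L :: "'a::ordered_euclidean_space \<Rightarrow> 'b::euclidean_space"
  assumes L: "linear L"
    and nonneg: "\<And>a. (\<And>x. 0 \<le> x \<Longrightarrow> 0 \<le> a \<bullet> L x) \<Longrightarrow> 0 \<le> a \<bullet> z"
  shows "\<exists>x\<ge>0. L x = z"
proof (rule ccontr)
  assume *: "\<not> ?thesis"
  have "convex (L ` {0..})"
    using L by (intro convex_linear_image) (auto simp: convex_def intro: scaleR_nonneg_nonneg add_nonneg_nonneg)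
  moreover have "z \<notin> L ` {0..}"
    using * by auto
  ultimately obtain a \<beta> where a: "a \<bullet> z < \<beta>" "\<And>x. 0 \<le> x \<Longrightarrow> \<beta> < a \<bullet> L x"
    using separating_hyperplane_closed_point[of "L ` {0..}" z] closed_linear_image_nonneg[OF L] by auto
  have "\<beta> < 0"
    using a(2)[of 0] linear_0[OF L] by simp
  have "0 \<le> a \<bullet> L x" if x: "0 \<le> x" for x
  proof (rule ccontr)
    assume neg: "\<not> 0 \<le> a \<bullet> L x"
    \<comment> \<open>With this factor the functional takes exactly the value \<open>\<beta>\<close>
      at \<open>L (t *\<^sub>R x)\<close>, against the strict bound.\<close>
    define t where "t = \<beta> / (a \<bullet> L x)"
    have "0 \<le> t"
      using neg \<open>\<beta> < 0\<close> by (simp add: t_def divide_nonpos_neg)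
    then have "0 \<le> t *\<^sub>R x"
      using x by (simp add: scaleR_nonneg_nonneg)
    from a(2)[OF this] show False
      using neg by (simp add: linear_scale[OF L] t_def)
  qed
  then have "0 \<le> a \<bullet> z" by (rule nonneg)
  then show False using a(1) \<open>\<beta> < 0\<close> by simp
qed

section \<open>Conjugate exponents and elementary properties of the norms\<close>

lemma conjugate_exponent_cases:
  fixes p q :: ereal
  assumes "1 \<le> p" "1 \<le> q" "1 / p + 1 / q = 1"
  obtains "p = 1" "q = \<infinity>" | "p = \<infinity>" "q = 1"
    | r s where "p = ereal r" "q = ereal s" "1 < r" "1 < s" "1 / r + 1 / s = 1"
proof (cases p)
  case p: (real r)
  show ?thesis
  proof (cases q)
    case q: (real s)
    have "1 \<le> r" "1 \<le> s" using assms p q by (auto simp: one_ereal_def)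
    moreover have "1 / r + 1 / s = 1"
      using assms p q calculation by (auto simp: one_ereal_def)
    \<comment> \<open>If one exponent were 1, the reciprocal of the other finite exponent would have
      to vanish.\<close>
    moreover from this have "r \<noteq> 1" "s \<noteq> 1" using calculation by auto
    ultimately show ?thesis using that(3)[of r s] p q by auto
  next
    case PInf
    have "1 \<le> r" "1 / r = 1" using assms p PInf by (auto simp: one_ereal_def)
    then have "p = 1" using p by (simp add: one_ereal_def)
    then show ?thesis using that(1) PInf by simp
  next
    case MInf
    then show ?thesis using assms by simp
  qed
next
  case p: PInf
  show ?thesis
  proof (cases q)
    case (real s)
    have "1 \<le> s" "1 / s = 1" using assms p real by (auto simp: one_ereal_def)
    then have "q = 1" using real by (simp add: one_ereal_def)
    then show ?thesis using that(2) p by simp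
  qed (use assms p in auto)
next
  case MInf
  then show ?thesis using assms by simp
qed

lemma lp_norm_infinity [simp]: "lp_norm \<infinity> = infnorm"
  by (simp add: lp_norm_def fun_eq_iff)

lemma lp_norm_ereal:
  "lp_norm (ereal r) v = (\<Sum>i\<in>Basis. \<bar>v \<bullet> i\<bar> powr r) powr (1 / r)"
  by (simp add: lp_norm_def)

lemma lp_norm_one: "lp_norm 1 v = (\<Sum>i\<in>Basis. \<bar>v \<bullet> i\<bar>)"
  by (simp add: lp_norm_def one_ereal_def sum_nonneg)

lemma lp_exponent_cases:
  assumes "1 \<le> (p::ereal)"
  obtains "p = \<infinity>" | r where "p = ereal r" "1 \<le> r"
  using assms by (cases p) (auto simp: one_ereal_def)

lemma lp_norm_nonneg [simp]: "0 \<le> lp_norm p v"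
  by (simp add: lp_norm_def infnorm_pos_le)

text \<open>This serves to replace the last coordinate of a displacement from the incumbent by its
  positive part without increasing the norm.\<close>

lemma lp_norm_mono:
  assumes "1 \<le> p" and le: "\<And>i. i \<in> Basis \<Longrightarrow> \<bar>u \<bullet> i\<bar> \<le> \<bar>v \<bullet> i\<bar>"
  shows "lp_norm p u \<le> lp_norm p v"
  using assms(1)
proof (cases rule: lp_exponent_cases)
  case 1
  have "\<bar>u \<bullet> i\<bar> \<le> infnorm v" if "i \<in> Basis" for i
    using le[OF that] Basis_le_infnorm[OF that, of v] by simp
  then have "infnorm u \<le> infnorm v"
    unfolding infnorm_Max[of u] by simp
  then show ?thesis using 1 by simp
next
  case (2 r)
  then show ?thesis
    unfolding 2 lp_norm_ereal by (intro powr_mono2 sum_mono sum_nonneg) (auto intro: le)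
qed

lemma abs_inner_le_lp_norm:
  assumes "1 \<le> p" "i \<in> Basis"
  shows "\<bar>v \<bullet> i\<bar> \<le> lp_norm p v"
  using assms(1)
proof (cases rule: lp_exponent_cases)
  case 1
  then show ?thesis using assms Basis_le_infnorm by auto
next
  case (2 r)
  have "\<bar>v \<bullet> i\<bar> = (\<bar>v \<bullet> i\<bar> powr r) powr (1 / r)"
    using 2 by (simp add: powr_powr)
  also have "\<dots> \<le> (\<Sum>i\<in>Basis. \<bar>v \<bullet> i\<bar> powr r) powr (1 / r)"
    using 2 assms(2) by (intro powr_mono2 member_le_sum) auto
  finally show ?thesis by (simp add: 2 lp_norm_ereal)
qed

lemma infnorm_le_lp_norm: "1 \<le> p \<Longrightarrow> infnorm v \<le> lp_norm p v"
  by (simp add: infnorm_Max abs_inner_le_lp_norm)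

lemma lp_norm_zero [simp]: "1 \<le> p \<Longrightarrow> lp_norm p 0 = 0"
  by (erule lp_exponent_cases) (auto simp: lp_norm_ereal infnorm_0)

lemma lp_norm_eq_0 [simp]: "1 \<le> p \<Longrightarrow> lp_norm p v = 0 \<longleftrightarrow> v = 0"
  using infnorm_le_lp_norm[of p v] infnorm_pos_le[of v] infnorm_eq_0[of v] lp_norm_zero[of p] by force

lemma lp_norm_scaleR:
  assumes "1 \<le> p"
  shows "lp_norm p (a *\<^sub>R v) = \<bar>a\<bar> * lp_norm p v"
  using assms
proof (cases rule: lp_exponent_cases)
  case 1
  then show ?thesis by (simp add: infnorm_mul)
next
  case (2 r)
  have "(\<Sum>i\<in>Basis. \<bar>(a *\<^sub>R v) \<bullet> i\<bar> powr r) = \<bar>a\<bar> powr r * (\<Sum>i\<in>Basis. \<bar>v \<bullet> i\<bar> powr r)"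
    by (simp add: abs_mult powr_mult sum_distrib_left)
  then show ?thesis
    using 2 by (simp add: lp_norm_ereal powr_mult powr_powr sum_nonneg)
qed

lemma continuous_on_lp_norm:
  assumes "1 \<le> p"
  shows "continuous_on S (lp_norm p)"
  using assms
proof (cases rule: lp_exponent_cases)
  case 1
  then show ?thesis by (simp add: continuous_on_infnorm continuous_on_id[unfolded id_def])
next
  case (2 r)
  then show ?thesis
    unfolding 2 lp_norm_ereal
    by (intro continuous_on_powr' continuous_on_sum continuous_intros) (auto intro: sum_nonneg)
qed

section \<open>Hoelder's inequality and duality of the norms\<close>

lemma holder_one_infinity:
  "u \<bullet> v \<le> lp_norm 1 u * lp_norm \<infinity> (v::'a::euclidean_space)"
proof -
  have "u \<bullet> v = (\<Sum>i\<in>Basis. (u \<bullet> i) * (v \<bullet> i))"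
    by (rule euclidean_inner)
  also have "\<dots> \<le> (\<Sum>i\<in>Basis. \<bar>u \<bullet> i\<bar> * infnorm v)"
  proof (rule sum_mono)
    fix i :: 'a assume "i \<in> Basis"
    then have "\<bar>u \<bullet> i\<bar> * \<bar>v \<bullet> i\<bar> \<le> \<bar>u \<bullet> i\<bar> * infnorm v"
      by (intro mult_left_mono Basis_le_infnorm) auto
    then show "(u \<bullet> i) * (v \<bullet> i) \<le> \<bar>u \<bullet> i\<bar> * infnorm v"
      using abs_le_D1[of "(u \<bullet> i) * (v \<bullet> i)"] by (simp add: abs_mult)
  qed
  finally show ?thesis by (simp add: lp_norm_one sum_distrib_right)
qed

text \<open>After both vectors are divided by their norms, Young's inequality applies in each
  coordinate, and the bounds sum to \<open>1 / r + 1 / s = 1\<close>.\<close>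

lemma holder_finite:
  fixes u v :: "'a::euclidean_space"
  assumes r: "1 < r" and s: "1 < s" and rs: "1 / r + 1 / s = 1"
  shows "u \<bullet> v \<le> lp_norm (ereal r) u * lp_norm (ereal s) v"
proof (cases "u = 0 \<or> v = 0")
  case True
  then show ?thesis by auto
next
  case False
  have r1: "1 \<le> ereal r" "1 \<le> ereal s" using r s by (auto simp: one_ereal_def)
  define a where "a = lp_norm (ereal r) u"
  define d where "d = lp_norm (ereal s) v"
  have pos: "0 < a" "0 < d"
    using False r1 by (auto simp: a_def d_def less_le)
  have unit: "(\<Sum>i\<in>Basis. (\<bar>w \<bullet> i\<bar> / lp_norm (ereal t) w) powr t) = 1"
    if t: "1 < t" and w: "w \<noteq> 0" for t and w :: 'a
  proof -
    let ?S = "\<Sum>i\<in>Basis. \<bar>w \<bullet> i\<bar> powr t"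
    have "lp_norm (ereal t) w \<noteq> 0" using t w by (simp add: one_ereal_def)
    then have "?S \<noteq> 0" by (auto simp: lp_norm_ereal)
    moreover have "lp_norm (ereal t) w powr t = ?S"
      using t by (simp add: lp_norm_ereal powr_powr sum_nonneg)
    ultimately show ?thesis
      by (simp add: powr_divide flip: sum_divide_distrib)
  qed
  have "u \<bullet> v / (a * d) = (\<Sum>i\<in>Basis. (u \<bullet> i) / a * ((v \<bullet> i) / d))"
    by (simp add: euclidean_inner[of u v] sum_divide_distrib)
  also have "\<dots> \<le> (\<Sum>i\<in>Basis. (\<bar>u \<bullet> i\<bar> / a) powr r / r + (\<bar>v \<bullet> i\<bar> / d) powr s / s)"
  proof (rule sum_mono)
    fix i :: 'a
    have "(u \<bullet> i) / a * ((v \<bullet> i) / d) \<le> \<bar>u \<bullet> i\<bar> / a * (\<bar>v \<bullet> i\<bar> / d)"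
      using pos abs_ge_self[of "(u \<bullet> i) / a * ((v \<bullet> i) / d)"] by (simp add: abs_mult)
    also have "\<dots> \<le> (\<bar>u \<bullet> i\<bar> / a) powr r / r + (\<bar>v \<bullet> i\<bar> / d) powr s / s"
      using assms pos by (intro Youngs_inequality) auto
    finally show "(u \<bullet> i) / a * ((v \<bullet> i) / d) \<le> \<dots>" .
  qed
  also have "\<dots> = 1 / r + 1 / s"
    using False r s unit[of r u] unit[of s v]
    by (simp add: sum.distrib a_def d_def flip: sum_divide_distrib)
  finally show ?thesis
    using rs pos by (simp add: a_def d_def divide_le_eq)
qed

lemma holder:
  assumes "1 \<le> p" "1 \<le> q" "1 / p + 1 / q = 1"
  shows "u \<bullet> v \<le> lp_norm p u * lp_norm q (v::'a::euclidean_space)"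
  using assms
proof (cases rule: conjugate_exponent_cases)
  case 1
  then show ?thesis using holder_one_infinity by simp
next
  case 2
  then show ?thesis using holder_one_infinity[of v u] by (simp add: inner_commute mult.commute)
next
  case (3 r s)
  then show ?thesis using holder_finite by simp
qed

text \<open>The witnesses are the equality cases of Hoelder's inequality: the sign vector of
  \<open>u\<close> for \<open>p = 1\<close>, a signed basis vector at a coordinate of largest
  modulus for \<open>p = \<infinity>\<close>, and otherwise the signed powers of the normalized
  coordinates with exponent \<open>r - 1\<close>.\<close>

lemma lp_norm_dual_attained:
  fixes u :: "'a::euclidean_space"
  assumes "1 \<le> p" "1 \<le> q" "1 / p + 1 / q = 1"
  shows "\<exists>v. lp_norm q v \<le> 1 \<and> u \<bullet> v = lp_norm p u"
  using assms
proof (cases rule: conjugate_exponent_cases)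
  case 1
  let ?v = "\<Sum>i\<in>Basis. sgn (u \<bullet> i) *\<^sub>R i"
  have "lp_norm q ?v \<le> 1"
    using 1 by (simp add: infnorm_Max abs_sgn_eq)
  moreover have "u \<bullet> ?v = lp_norm p u"
    using 1 by (simp add: inner_sum_right lp_norm_one abs_sgn mult.commute)
  ultimately show ?thesis by blast
next
  case 2
  have "infnorm u \<in> (\<lambda>i. \<bar>u \<bullet> i\<bar>) ` Basis"
    unfolding infnorm_Max by (intro Max_in) auto
  then obtain j where j: "j \<in> Basis" "infnorm u = \<bar>u \<bullet> j\<bar>" by blast
  let ?v = "sgn (u \<bullet> j) *\<^sub>R j"
  have "lp_norm 1 j = 1"
    using j by (simp add: lp_norm_one inner_Basis if_distrib[of abs] cong: if_cong)
  then have "lp_norm q ?v \<le> 1"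
    using 2 by (simp add: lp_norm_scaleR abs_sgn_eq)
  moreover have "u \<bullet> ?v = lp_norm p u"
    using 2 j by (simp add: abs_sgn mult.commute)
  ultimately show ?thesis by blast
next
  case (3 r s)
  show ?thesis
  proof (cases "u = 0")
    case True
    then show ?thesis using assms by (intro exI[of _ 0]) simp
  next
    case False
    define N where "N = lp_norm p u"
    define v where "v = (\<Sum>i\<in>Basis. (sgn (u \<bullet> i) * (\<bar>u \<bullet> i\<bar> / N) powr (r - 1)) *\<^sub>R i)"
    have "0 < N" using False assms by (simp add: N_def less_le)
    have Nr: "N powr r = (\<Sum>i\<in>Basis. \<bar>u \<bullet> i\<bar> powr r)"
      using 3 by (simp add: N_def lp_norm_ereal powr_powr sum_nonneg)
    \<comment> \<open>This form of conjugacy makes the \<open>s\<close>-th powers of the coordinates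
      of \<open>v\<close> equal to the \<open>r\<close>-th powers of the normalized coordinates of
      \<open>u\<close>, which sum to 1.\<close>
    have rs: "(r - 1) * s = r"
      using 3 by (simp add: field_simps)
    have "(\<Sum>i\<in>Basis. \<bar>v \<bullet> i\<bar> powr s) = (\<Sum>i\<in>Basis. (\<bar>u \<bullet> i\<bar> / N) powr r)"
    proof (rule sum.cong)
      fix i :: 'a assume "i \<in> Basis"
      then have "\<bar>v \<bullet> i\<bar> = (\<bar>u \<bullet> i\<bar> / N) powr (r - 1)"
        using \<open>0 < N\<close> by (auto simp: v_def abs_mult abs_sgn_eq)
      then show "\<bar>v \<bullet> i\<bar> powr s = (\<bar>u \<bullet> i\<bar> / N) powr r"
        using rs by (simp add: powr_powr)
    qed simp
    also have "\<dots> = 1"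
      using \<open>0 < N\<close> by (simp add: powr_divide flip: sum_divide_distrib Nr)
    finally have "lp_norm q v = 1"
      using 3 by (simp add: lp_norm_ereal)
    moreover have "u \<bullet> v = N"
    proof -
      have "u \<bullet> v = (\<Sum>i\<in>Basis. \<bar>u \<bullet> i\<bar> powr r / N powr (r - 1))"
        unfolding v_def inner_sum_right
      proof (rule sum.cong)
        fix i :: 'a
        have "u \<bullet> ((sgn (u \<bullet> i) * (\<bar>u \<bullet> i\<bar> / N) powr (r - 1)) *\<^sub>R i)
            = \<bar>u \<bullet> i\<bar> * (\<bar>u \<bullet> i\<bar> / N) powr (r - 1)"
          by (simp add: abs_sgn mult_ac)
        also have "\<dots> = \<bar>u \<bullet> i\<bar> powr r / N powr (r - 1)"
          using \<open>0 < N\<close> by (simp add: powr_divide powr_mult_base)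
        finally show "u \<bullet> ((sgn (u \<bullet> i) * (\<bar>u \<bullet> i\<bar> / N) powr (r - 1)) *\<^sub>R i) = \<dots>" .
      qed simp
      also have "\<dots> = N powr r / N powr (r - 1)"
        by (simp add: Nr sum_divide_distrib)
      also have "\<dots> = N"
        using \<open>0 < N\<close> by (simp flip: powr_diff)
      finally show ?thesis .
    qed
    ultimately show ?thesis unfolding N_def by (intro exI[of _ v]) simp
  qed
qed

text \<open>A vector \<open>w\<close> of the dual unit ball that attains the norm of
  \<open>u + v\<close> pairs with each summand to at most the norm of that summand, so Minkowski's
  inequality follows from duality.\<close>

lemma lp_norm_triangle:
  fixes u v :: "'a::euclidean_space"
  assumes "1 \<le> p" "1 \<le> q" "1 / p + 1 / q = 1"
  shows "lp_norm p (u + v) \<le> lp_norm p u + lp_norm p v"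
proof -
  obtain w where w: "lp_norm q w \<le> 1" "(u + v) \<bullet> w = lp_norm p (u + v)"
    using lp_norm_dual_attained[OF assms] by blast
  have "z \<bullet> w \<le> lp_norm p z" for z
    using holder[OF assms, of z w] mult_left_mono[OF w(1), of "lp_norm p z"] by simp
  from this[of u] this[of v] show ?thesis
    using w(2) by (simp add: inner_add_left)
qed

section \<open>Nearest points and separation from balls\<close>

lemma lp_norm_nearest_point:
  fixes S :: "'a::euclidean_space set"
  assumes q: "1 \<le> q" and S: "closed S" "S \<noteq> {}"
  shows "\<exists>z\<in>S. \<forall>z'\<in>S. lp_norm q (z - w) \<le> lp_norm q (z' - w)"
proof -
  obtain z0 where z0: "z0 \<in> S" using S by blast
  define R where "R = lp_norm q (z0 - w)"
  \<comment> \<open>Points outside this sublevel set are farther from \<open>w\<close> than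
    \<open>z0\<close>. Comparison with \<open>infnorm\<close> bounds the set, so it is
    compact.\<close>
  define T where "T = S \<inter> {z. lp_norm q (z - w) \<le> R}"
  have cont: "continuous_on UNIV (\<lambda>z. lp_norm q (z - w))"
    by (rule continuous_on_compose2[OF continuous_on_lp_norm[OF q, of UNIV]])
      (auto intro!: continuous_intros)
  have "closed T"
    unfolding T_def using S cont by (intro closed_Int closed_Collect_le) (auto intro: continuous_intros)
  moreover have "T \<subseteq> cball w (sqrt DIM('a) * R)"
  proof
    fix z assume "z \<in> T"
    then have "infnorm (z - w) \<le> R"
      using infnorm_le_lp_norm[OF q, of "z - w"] by (simp add: T_def)
    then have "norm (z - w) \<le> sqrt DIM('a) * R"
      using norm_le_infnorm[of "z - w"] by (meson mult_left_mono order_trans real_sqrt_ge_zero of_nat_0_le_iff)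
    then show "z \<in> cball w (sqrt DIM('a) * R)" by (simp add: dist_norm norm_minus_commute)
  qed
  ultimately have "compact T"
    using bounded_subset bounded_cball by (auto simp: compact_eq_bounded_closed)
  moreover have "z0 \<in> T" using z0 by (simp add: T_def R_def)
  ultimately obtain z where z: "z \<in> T" "\<And>z'. z' \<in> T \<Longrightarrow> lp_norm q (z - w) \<le> lp_norm q (z' - w)"
    using continuous_attains_inf[of T "\<lambda>z. lp_norm q (z - w)"] continuous_on_subset[OF cont] by blast
  have "lp_norm q (z - w) \<le> lp_norm q (z' - w)" if "z' \<in> S" for z'
  proof (cases "z' \<in> T")
    case False
    then have "R < lp_norm q (z' - w)" using that by (simp add: T_def)
    then show ?thesis using z(1) by (simp add: T_def)
  qed (rule z(2))
  then show ?thesis using z(1) by (auto simp: T_def)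
qed

text \<open>The hyperplane separates \<open>S\<close> from the open ball of radius \<open>d\<close>
  around \<open>w\<close>. The margin arises because the supremum of \<open>g\<close> over this ball
  is \<open>g \<bullet> w + d * lp_norm p g\<close>.\<close>

lemma lp_norm_separation:
  fixes S :: "'a::euclidean_space set"
  assumes pq: "1 \<le> p" "1 \<le> q" "1 / p + 1 / q = 1"
    and S: "convex S" "S \<noteq> {}" and d: "0 < d"
    and dist: "\<And>z. z \<in> S \<Longrightarrow> d \<le> lp_norm q (z - w)"
  shows "\<exists>g. g \<noteq> 0 \<and> (\<forall>z\<in>S. g \<bullet> w + d * lp_norm p g \<le> g \<bullet> z)"
proof -
  have qp: "1 \<le> q" "1 \<le> p" "1 / q + 1 / p = 1"
    using pq by (simp_all add: add.commute)
  define U where "U = {z. lp_norm q (z - w) < d}"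
  have "convex U"
    unfolding convex_alt
  proof (intro ballI allI impI)
    fix x y t assume *: "x \<in> U" "y \<in> U" "0 \<le> t \<and> t \<le> (1::real)"
    have "((1 - t) *\<^sub>R x + t *\<^sub>R y) - w = (1 - t) *\<^sub>R (x - w) + t *\<^sub>R (y - w)"
      by (simp add: algebra_simps)
    then have "lp_norm q (((1 - t) *\<^sub>R x + t *\<^sub>R y) - w)
        \<le> (1 - t) * lp_norm q (x - w) + t * lp_norm q (y - w)"
      using lp_norm_triangle[OF qp, of "(1 - t) *\<^sub>R (x - w)" "t *\<^sub>R (y - w)"] *
      by (simp add: lp_norm_scaleR qp)
    also have "\<dots> < d"
      using * by (intro convex_bound_lt) (auto simp: U_def)
    finally show "(1 - t) *\<^sub>R x + t *\<^sub>R y \<in> U" by (simp add: U_def)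
  qed
  moreover have "w \<in> U" using d pq by (simp add: U_def)
  moreover have "U \<inter> S = {}" using dist by (force simp: U_def)
  ultimately obtain g \<beta> where g: "g \<noteq> 0" "\<And>z. z \<in> U \<Longrightarrow> g \<bullet> z \<le> \<beta>" "\<And>z. z \<in> S \<Longrightarrow> \<beta> \<le> g \<bullet> z"
    using separating_hyperplane_sets[of U S] S by blast
  obtain v where v: "lp_norm q v \<le> 1" "g \<bullet> v = lp_norm p g"
    using lp_norm_dual_attained[OF pq] by blast
  \<comment> \<open>The extremal point \<open>w + d *\<^sub>R v\<close> may lie on the boundary of
    the open ball, so it is approached by the factors \<open>r < 1\<close>.\<close>
  have "d * lp_norm p g \<le> \<beta> - g \<bullet> w"
  proof (rule field_le_mult_one_interval)
    fix r :: real assume r: "0 < r" "r < 1"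
    have "r * d * lp_norm q v \<le> r * d * 1"
      using r d v(1) by (intro mult_left_mono) auto
    also have "\<dots> < d"
      using r d by simp
    finally have "w + (r * d) *\<^sub>R v \<in> U"
      using r d qp by (simp add: U_def lp_norm_scaleR)
    from g(2)[OF this] show "r * (d * lp_norm p g) \<le> \<beta> - g \<bullet> w"
      by (simp add: v(2) inner_add_right mult.assoc)
  qed
  then show ?thesis using g by fastforce
qed

section \<open>The componentwise order and weak duality\<close>

lemma inner_vec_mono:
  fixes \<pi> u v :: "real^'m"
  assumes "0 \<le> \<pi>" "u \<le> v"
  shows "\<pi> \<bullet> u \<le> \<pi> \<bullet> v"
  using assms by (auto simp: inner_vec_def less_eq_vec_def intro!: sum_mono mult_left_mono)

lemma vec_nonnegI:
  fixes u :: "real^'m"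
  assumes "\<And>\<pi>. 0 \<le> \<pi> \<Longrightarrow> 0 \<le> \<pi> \<bullet> u"
  shows "0 \<le> u"
  unfolding less_eq_vec_def
proof
  fix i
  have "0 \<le> (axis i 1 :: real^'m)"
    by (simp add: less_eq_vec_def axis_def)
  from assms[OF this] show "0 $ i \<le> u $ i"
    by (simp add: inner_axis')
qed

lemma linear_vector_matrix_mult: "linear (\<lambda>\<pi>::real^'m. \<pi> v* A)"
  by (simp flip: transpose_matrix_vector)

text \<open>Weighting the primal constraints by the multipliers bounds the violation by the pairing
  of the cut's normal with the displacement, to which Hoelder's inequality applies. The product form
  also covers cuts with vanishing norm.\<close>

lemma weak_duality:
  fixes A :: "real^'k^'m" and B :: "real^'n^'m"
  assumes pq: "1 \<le> p" "1 \<le> q" "1 / p + 1 / q = 1"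
    and s: "s \<in> dual_cone A c" and z: "z \<in> lagrangian_feasible A B b c f \<eta>h"
  shows "cut_violation B b f yh \<eta>h s \<le> cut_norm p B f s * lagrangian_objective q yh \<eta>h z"
proof -
  obtain \<pi> \<pi>0 y x \<eta> where sz: "s = (\<pi>, \<pi>0)" "z = (y, x, \<eta>)"
    by (metis prod.exhaust)
  have dual: "\<pi> v* A \<le> \<pi>0 *\<^sub>R c" "0 \<le> \<pi>" "0 \<le> \<pi>0"
    and primal: "c \<bullet> x + f \<bullet> y \<le> \<eta>" "b - B *v y \<le> A *v x" "0 \<le> x"
    using s z by (auto simp: sz dual_cone_def lagrangian_feasible_def)
  have "\<pi> \<bullet> (b - B *v y) \<le> (\<pi> v* A) \<bullet> x"
    using inner_vec_mono[OF dual(2) primal(2)] by (simp add: dot_lmul_matrix)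
  also have "\<dots> \<le> \<pi>0 * (c \<bullet> x)"
    using inner_vec_mono[OF primal(3) dual(1)] by (simp add: inner_commute)
  also have "\<dots> \<le> \<pi>0 * (\<eta> - f \<bullet> y)"
    using primal(1) dual(3) by (intro mult_left_mono) auto
  finally have "cut_violation B b f yh \<eta>h s \<le> (\<pi> v* B - \<pi>0 *\<^sub>R f, \<pi>0) \<bullet> (y - yh, \<eta> - \<eta>h)"
    by (simp add: sz cut_violation_def inner_diff dot_lmul_matrix matrix_vector_mult_diff_distrib algebra_simps)
  also have "\<dots> \<le> cut_norm p B f s * lagrangian_objective q yh \<eta>h z"
    using holder[OF pq, of "(\<pi> v* B - \<pi>0 *\<^sub>R f, \<pi>0)" "(y - yh, \<eta> - \<eta>h)"]
    by (simp add: sz cut_norm_def lagrangian_objective_def)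
  finally show ?thesis .
qed

text \<open>If the denominator vanishes, weak duality makes the numerator nonpositive, so the
  quotient in \<open>ereal\<close> is 0 or \<open>-\<infinity>\<close> and stays below the
  nonnegative objective.\<close>

lemma cut_depth_le_objective:
  fixes A :: "real^'k^'m" and B :: "real^'n^'m"
  assumes pq: "1 \<le> p" "1 \<le> q" "1 / p + 1 / q = 1"
    and s: "s \<in> dual_cone A c" and z: "z \<in> lagrangian_feasible A B b c f \<eta>h"
  shows "cut_depth p B b f yh \<eta>h s \<le> ereal (lagrangian_objective q yh \<eta>h z)"
proof -
  have *: "0 \<le> cut_norm p B f s" "0 \<le> lagrangian_objective q yh \<eta>h z"
    by (auto simp: cut_norm_def lagrangian_objective_def split: prod.split)
  show ?thesis
  proof (cases "cut_norm p B f s = 0")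
    case True
    then have "cut_violation B b f yh \<eta>h s \<le> 0"
      using weak_duality[OF assms, of yh] by simp
    then show ?thesis
      using True * by (auto simp: cut_depth_def divide_ereal_def less_le)
  next
    case False
    then show ?thesis
      using * weak_duality[OF assms, of yh] by (simp add: cut_depth_def divide_le_eq mult.commute)
  qed
qed

section \<open>Dual certificates for valid inequalities\<close>

text \<open>
  The variable \<open>t\<close> homogenizes the right-hand side: \<open>t = 1\<close> gives the primal points and \<open>t = 0\<close>
  the recession directions.
\<close>

lemma homogeneous_dual_certificate:
  fixes A :: "real^'k^'m" and B :: "real^'n^'m"
  assumes valid: "\<And>y x \<eta> t. 0 \<le> t \<Longrightarrow> c \<bullet> x + f \<bullet> y \<le> \<eta> \<Longrightarrow> t *\<^sub>R b - B *v y \<le> A *v x \<Longrightarrow> 0 \<le> x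
      \<Longrightarrow> t * \<alpha> \<le> g \<bullet> y + \<gamma> * \<eta>"
  shows "\<exists>\<pi>. (\<pi>, \<gamma>) \<in> dual_cone A c \<and> \<pi> v* B - \<gamma> *\<^sub>R f = g \<and> \<alpha> \<le> \<pi> \<bullet> b"
proof -
  \<comment> \<open>The variables \<open>\<tau>\<close> and \<open>\<rho>\<close> are slacks for the
    dual inequality and for \<open>\<alpha> \<le> \<pi> \<bullet> b\<close>, so that the claim
    becomes solvability of \<open>L s = (g, \<gamma>, 0, \<alpha>)\<close> with \<open>s\<close>
    nonnegative.\<close>
  define L :: "(real^'m) \<times> real \<times> (real^'k) \<times> real \<Rightarrow> (real^'n) \<times> real \<times> (real^'k) \<times> real"
    where "L = (\<lambda>(\<pi>, \<pi>0, \<tau>, \<rho>). (\<pi> v* B - \<pi>0 *\<^sub>R f, \<pi>0, \<pi> v* A - \<pi>0 *\<^sub>R c + \<tau>, \<pi> \<bullet> b - \<rho>))"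
  have "linear L"
    using linear_vector_matrix_mult[of A] linear_vector_matrix_mult[of B]
    by (auto simp: L_def linear_iff algebra_simps inner_simps)
  then have "\<exists>s\<ge>0. L s = (g, \<gamma>, 0, \<alpha>)"
  proof (rule farkas)
    fix a :: "(real^'n) \<times> real \<times> (real^'k) \<times> real"
    assume a: "\<And>s. 0 \<le> s \<Longrightarrow> 0 \<le> a \<bullet> L s"
    obtain y \<eta> x t where a_eq: "a = (y, \<eta>, x, t)" by (metis prod.exhaust)
    \<comment> \<open>Testing \<open>a\<close> on each block of \<open>s\<close> recovers the
      homogenized primal constraints. The slack \<open>\<rho>\<close> enters with a minus sign, so
      the homogenizing variable is \<open>- t\<close>.\<close>
    have "0 \<le> \<pi> \<bullet> (B *v y + A *v x + t *\<^sub>R b)" if "0 \<le> \<pi>" for \<pi>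
      using a[of "(\<pi>, 0, 0, 0)"] that
      by (simp add: a_eq L_def less_eq_prod_def inner_commute[of y] inner_commute[of x] dot_lmul_matrix inner_add_right)
    then have "0 \<le> B *v y + A *v x + t *\<^sub>R b"
      by (rule vec_nonnegI)
    then have "(- t) *\<^sub>R b - B *v y \<le> A *v x"
      by (subst diff_ge_0_iff_ge[symmetric]) (simp add: algebra_simps)
    moreover
    have "0 \<le> \<tau> \<bullet> x" if "0 \<le> \<tau>" for \<tau>
      using a[of "(0, 0, \<tau>, 0)"] that
      by (simp add: a_eq L_def less_eq_prod_def inner_commute)
    then have "0 \<le> x"
      by (rule vec_nonnegI)
    moreover have "c \<bullet> x + f \<bullet> y \<le> \<eta>"
      using a[of "(0, 1, 0, 0)"] by (simp add: a_eq L_def less_eq_prod_def inner_commute)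
    moreover have "0 \<le> - t"
      using a[of "(0, 0, 0, 1)"] by (simp add: a_eq L_def less_eq_prod_def)
    ultimately show "0 \<le> a \<bullet> (g, \<gamma>, 0, \<alpha>)"
      using valid[of "- t" x y \<eta>] by (simp add: a_eq inner_commute mult.commute)
  qed
  then obtain \<pi> \<tau> \<rho> where "0 \<le> \<pi>" "0 \<le> \<gamma>" "0 \<le> \<tau>" "0 \<le> \<rho>"
    "\<pi> v* B - \<gamma> *\<^sub>R f = g" "\<pi> v* A - \<gamma> *\<^sub>R c + \<tau> = 0" "\<pi> \<bullet> b - \<rho> = \<alpha>"
    by (auto simp: L_def less_eq_prod_def)
  moreover from this have "\<pi> v* A \<le> \<gamma> *\<^sub>R c"
    by (simp add: less_eq_vec_def vec_eq_iff) (smt (verit))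
  ultimately show ?thesis
    by (intro exI[of _ \<pi>]) (auto simp: dual_cone_def)
qed

lemma dehomogenize:
  fixes A :: "real^'k^'m" and B :: "real^'n^'m"
  assumes t: "0 < t" and "t *\<^sub>R b - B *v y \<le> A *v x" "0 \<le> x"
  shows "b - B *v ((1 / t) *\<^sub>R y) \<le> A *v ((1 / t) *\<^sub>R x)" "0 \<le> (1 / t) *\<^sub>R x"
proof -
  have "(1 / t) *\<^sub>R (t *\<^sub>R b - B *v y) \<le> (1 / t) *\<^sub>R (A *v x)"
    using assms by (intro scaleR_left_mono) auto
  then show "b - B *v ((1 / t) *\<^sub>R y) \<le> A *v ((1 / t) *\<^sub>R x)"
    using t by (simp add: scaleR_diff_right matrix_vector_mult_scaleR)
  show "0 \<le> (1 / t) *\<^sub>R x"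
    using assms by (simp add: scaleR_nonneg_nonneg)
qed

text \<open>A solution of the homogenized system with \<open>t > 0\<close> would rescale to a
  feasible point. Hence \<open>t = 0\<close> throughout and the inequality
  \<open>t * 1 \<le> 0\<close> is valid; its certificate has zero normal and positive violation, and
  thus infinite depth.\<close>

lemma infeasible_dual_certificate:
  fixes A :: "real^'k^'m" and B :: "real^'n^'m"
  assumes empty: "lagrangian_feasible A B b c f \<eta>h = {}"
  shows "\<exists>s\<in>dual_cone A c. cut_depth p B b f yh \<eta>h s = \<infinity>"
proof -
  have "\<exists>\<pi>. (\<pi>, 0) \<in> dual_cone A c \<and> \<pi> v* B - 0 *\<^sub>R f = 0 \<and> 1 \<le> \<pi> \<bullet> b"
  proof (rule homogeneous_dual_certificate)
    fix y :: "real^'n" and x :: "real^'k" and \<eta> t :: real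
    assume *: "0 \<le> t" "t *\<^sub>R b - B *v y \<le> A *v x" "0 \<le> x"
    have "t = 0"
    proof (rule ccontr)
      assume "t \<noteq> 0"
      with * have t: "0 < t" by simp
      let ?x = "(1 / t) *\<^sub>R x" and ?y = "(1 / t) *\<^sub>R y"
      \<comment> \<open>The maximum satisfies both lower bounds on the last variable.\<close>
      have "(?y, ?x, max \<eta>h (c \<bullet> ?x + f \<bullet> ?y)) \<in> lagrangian_feasible A B b c f \<eta>h"
        using dehomogenize[OF t *(2,3)] by (simp add: lagrangian_feasible_def)
      then show False using empty by blast
    qed
    then show "t * 1 \<le> 0 \<bullet> y + 0 * \<eta>" by simp
  qed
  then obtain \<pi> where \<pi>: "(\<pi>, 0) \<in> dual_cone A c" "\<pi> v* B = 0" "0 < \<pi> \<bullet> b"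
    by force
  moreover have "cut_violation B b f yh \<eta>h (\<pi>, 0) = \<pi> \<bullet> b"
    using \<pi>(2) by (simp add: cut_violation_def inner_diff_right flip: dot_lmul_matrix)
  moreover have "cut_norm p B f (\<pi>, 0) = 0"
    using \<pi>(2) by (simp add: cut_norm_def lp_norm_def infnorm_eq_0 flip: zero_prod_def)
  ultimately show ?thesis
    by (intro bexI[of _ "(\<pi>, 0)"]) (auto simp: cut_depth_def divide_ereal_def)
qed

text \<open>Validity on the primal points extends to the homogenized system: for
  \<open>t > 0\<close> by scaling, and for \<open>t = 0\<close> because a negative slope along a
  recession direction from the given point would eventually violate the bound.\<close>

lemma dual_certificate:
  fixes A :: "real^'k^'m" and B :: "real^'n^'m"
  assumes feas: "c \<bullet> x0 + f \<bullet> y0 \<le> \<eta>0" "b - B *v y0 \<le> A *v x0" "0 \<le> x0"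
    and valid: "\<And>y x \<eta>. c \<bullet> x + f \<bullet> y \<le> \<eta> \<Longrightarrow> b - B *v y \<le> A *v x \<Longrightarrow> 0 \<le> x
      \<Longrightarrow> \<alpha> \<le> g \<bullet> y + \<gamma> * \<eta>"
  shows "\<exists>\<pi>. (\<pi>, \<gamma>) \<in> dual_cone A c \<and> \<pi> v* B - \<gamma> *\<^sub>R f = g \<and> \<alpha> \<le> \<pi> \<bullet> b"
proof (rule homogeneous_dual_certificate)
  fix y :: "real^'n" and x :: "real^'k" and \<eta> t :: real
  assume *: "0 \<le> t" "c \<bullet> x + f \<bullet> y \<le> \<eta>" "t *\<^sub>R b - B *v y \<le> A *v x" "0 \<le> x"
  show "t * \<alpha> \<le> g \<bullet> y + \<gamma> * \<eta>"
  proof (cases "t = 0")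
    case False
    with * have t: "0 < t" by simp
    let ?x = "(1 / t) *\<^sub>R x" and ?y = "(1 / t) *\<^sub>R y"
    have "c \<bullet> ?x + f \<bullet> ?y \<le> \<eta> / t"
      using t *(2) by (simp add: divide_right_mono flip: add_divide_distrib)
    from valid[OF this dehomogenize[OF t *(3,4)]]
    have "\<alpha> \<le> g \<bullet> ?y + \<gamma> * (\<eta> / t)" .
    then show ?thesis
      using t by (simp add: pos_le_divide_eq mult.commute flip: add_divide_distrib)
  next
    case True
    have ray: "\<alpha> - (g \<bullet> y0 + \<gamma> * \<eta>0) \<le> r * (g \<bullet> y + \<gamma> * \<eta>)" if r: "0 \<le> r" for r
    proof -
      have "r *\<^sub>R (- (B *v y)) \<le> r *\<^sub>R (A *v x)"
        using *(3) True r by (intro scaleR_left_mono) auto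
      from add_mono[OF feas(2) this]
      have "b - B *v (y0 + r *\<^sub>R y) \<le> A *v (x0 + r *\<^sub>R x)"
        by (simp add: matrix_vector_right_distrib matrix_vector_mult_scaleR algebra_simps)
      moreover have "0 \<le> x0 + r *\<^sub>R x"
        using feas(3) *(4) r by (simp add: scaleR_nonneg_nonneg)
      moreover have "c \<bullet> (x0 + r *\<^sub>R x) + f \<bullet> (y0 + r *\<^sub>R y) \<le> \<eta>0 + r * \<eta>"
        using add_mono[OF feas(1) mult_left_mono[OF *(2) r]] by (simp add: inner_add_right algebra_simps)
      ultimately have "\<alpha> \<le> g \<bullet> (y0 + r *\<^sub>R y) + \<gamma> * (\<eta>0 + r * \<eta>)"
        by (intro valid)
      then show ?thesis by (simp add: inner_add_right algebra_simps)
    qed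
    have "0 \<le> g \<bullet> y + \<gamma> * \<eta>"
    proof (rule ccontr)
      define D where "D = g \<bullet> y + \<gamma> * \<eta>"
      \<comment> \<open>With this \<open>e\<close>, the step \<open>e / (- D)\<close> makes the
        right-hand side of \<open>ray\<close> equal to \<open>- e\<close>, which is strictly below
        its left-hand side.\<close>
      define e where "e = \<bar>\<alpha> - (g \<bullet> y0 + \<gamma> * \<eta>0)\<bar> + 1"
      assume "\<not> 0 \<le> g \<bullet> y + \<gamma> * \<eta>"
      then have "D < 0" by (simp add: D_def)
      then have "- e = (e / (- D)) * D" by (simp add: field_simps)
      moreover have "0 \<le> e / (- D)" using \<open>D < 0\<close> by (intro divide_nonneg_pos) (auto simp: e_def)
      ultimately show False using ray[of "e / (- D)"] by (simp add: e_def flip: D_def)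
    qed
    then show ?thesis using True by simp
  qed
qed

section \<open>The projected feasible set and attainment of the minimum\<close>

lemma closed_convex_projection:
  fixes A :: "real^'k^'m" and B :: "real^'n^'m"
    and b :: "real^'m" and c :: "real^'k" and f :: "real^'n"
  defines "Q \<equiv> {(y, \<eta>). \<exists>x. c \<bullet> x + f \<bullet> y \<le> \<eta> \<and> b - B *v y \<le> A *v x \<and> 0 \<le> x}"
  shows "closed Q" "convex Q"
proof -
  \<comment> \<open>The slacks \<open>\<sigma>\<close> and \<open>\<rho>\<close> turn the
    inequalities into equations, so \<open>Q\<close> becomes the preimage under the linear map
    \<open>h\<close> of a translate of a finitely generated cone.\<close>
  define L :: "(real^'k) \<times> (real^'m) \<times> real \<Rightarrow> (real^'m) \<times> real"
    where "L = (\<lambda>(x, \<sigma>, \<rho>). (A *v x - \<sigma>, c \<bullet> x + \<rho>))"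
  define h :: "(real^'n) \<times> real \<Rightarrow> (real^'m) \<times> real"
    where "h = (\<lambda>(y, \<eta>). (- (B *v y), \<eta> - f \<bullet> y))"
  have L: "linear L"
    by (auto simp: L_def linear_iff matrix_vector_right_distrib matrix_vector_mult_scaleR
      inner_add_right algebra_simps)
  have h: "linear h"
    by (auto simp: h_def linear_iff matrix_vector_right_distrib matrix_vector_mult_scaleR
      inner_add_right algebra_simps)
  have "z \<in> Q \<longleftrightarrow> h z \<in> (+) (- (b, 0)) ` L ` {0..}" for z
  proof -
    obtain y \<eta> where z: "z = (y, \<eta>)" by fastforce
    have "h z \<in> (+) (- (b, 0)) ` L ` {0..}
      \<longleftrightarrow> (\<exists>x\<ge>0. \<exists>\<sigma>\<ge>0. \<exists>\<rho>\<ge>0. - (B *v y) = - b + (A *v x - \<sigma>) \<and> \<eta> - f \<bullet> y = c \<bullet> x + \<rho>)"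
      by (simp add: z h_def L_def image_image image_iff Bex_def less_eq_prod_def)
    also have "\<dots> \<longleftrightarrow> (\<exists>x\<ge>0. b - B *v y \<le> A *v x \<and> c \<bullet> x + f \<bullet> y \<le> \<eta>)"
    proof (rule ex_cong1, rule conj_cong[OF refl])
      fix x
      have "(\<exists>\<sigma>\<ge>0. - (B *v y) = - b + (A *v x - \<sigma>)) \<longleftrightarrow> b - B *v y \<le> A *v x"
      proof
        assume "\<exists>\<sigma>\<ge>0. - (B *v y) = - b + (A *v x - \<sigma>)"
        then obtain \<sigma> where \<sigma>: "0 \<le> \<sigma>" "- (B *v y) = - b + (A *v x - \<sigma>)"
          by blast
        from \<sigma>(2) have "A *v x - (b - B *v y) = \<sigma>"
          by (simp add: algebra_simps)
        then show "b - B *v y \<le> A *v x"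
          using \<sigma>(1) by (subst diff_ge_0_iff_ge[symmetric]) simp
      next
        assume "b - B *v y \<le> A *v x"
        then show "\<exists>\<sigma>\<ge>0. - (B *v y) = - b + (A *v x - \<sigma>)"
          by (intro exI[of _ "A *v x - (b - B *v y)"]) simp
      qed
      moreover have "(\<exists>\<rho>\<ge>0. \<eta> - f \<bullet> y = c \<bullet> x + \<rho>) \<longleftrightarrow> c \<bullet> x + f \<bullet> y \<le> \<eta>"
        by (auto intro!: exI[of _ "\<eta> - f \<bullet> y - c \<bullet> x"])
      ultimately show "(\<exists>\<sigma>\<ge>0. \<exists>\<rho>\<ge>0. - (B *v y) = - b + (A *v x - \<sigma>) \<and> \<eta> - f \<bullet> y = c \<bullet> x + \<rho>)
          \<longleftrightarrow> b - B *v y \<le> A *v x \<and> c \<bullet> x + f \<bullet> y \<le> \<eta>"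
        by blast
    qed
    finally show ?thesis by (auto simp: Q_def z)
  qed
  then have Q: "Q = h -` ((+) (- (b, 0)) ` L ` {0..})"
    by blast
  show "closed Q"
    unfolding Q using h closed_linear_image_nonneg[OF L]
    by (intro continuous_closed_vimage closed_translation linear_continuous_at)
      (auto simp: linear_conv_bounded_linear)
  have "convex (L ` {0..})"
    using L by (rule convex_linear_image) (auto simp: convex_def scaleR_nonneg_nonneg)
  then show "convex Q"
    unfolding Q using h by (intro convex_linear_vimage convex_translation)
qed

text \<open>The objective depends only on \<open>(y, \<eta>)\<close>, so a nearest point of the
  closed projection to the incumbent is optimal, and any \<open>x\<close> above it completes the
  minimizer.\<close>

lemma lagrangian_minimum_attained:
  fixes A :: "real^'k^'m" and B :: "real^'n^'m"
  assumes q: "1 \<le> q" and feas: "lagrangian_feasible A B b c f \<eta>h \<noteq> {}"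
  shows "\<exists>z\<in>lagrangian_feasible A B b c f \<eta>h. \<forall>z'\<in>lagrangian_feasible A B b c f \<eta>h.
    lagrangian_objective q yh \<eta>h z \<le> lagrangian_objective q yh \<eta>h z'"
proof -
  let ?F = "lagrangian_feasible A B b c f \<eta>h"
  define Q where "Q = {(y, \<eta>). \<exists>x. c \<bullet> x + f \<bullet> y \<le> \<eta> \<and> b - B *v y \<le> A *v x \<and> 0 \<le> x}"
  define S where "S = Q \<inter> {z. \<eta>h \<le> snd z}"
  have S: "(y, \<eta>) \<in> S \<longleftrightarrow> (\<exists>x. (y, x, \<eta>) \<in> ?F)" for y \<eta>
    by (auto simp: S_def Q_def lagrangian_feasible_def)
  have "closed S"
    unfolding S_def Q_def
    by (intro closed_Int closed_convex_projection closed_Collect_le continuous_intros)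
  moreover have "S \<noteq> {}"
    using feas S by fastforce
  ultimately obtain y \<eta> where z: "(y, \<eta>) \<in> S"
    "\<And>z'. z' \<in> S \<Longrightarrow> lp_norm q ((y, \<eta>) - (yh, \<eta>h)) \<le> lp_norm q (z' - (yh, \<eta>h))"
    using lp_norm_nearest_point[OF q, of S "(yh, \<eta>h)"] by fastforce
  then obtain x where x: "(y, x, \<eta>) \<in> ?F" using S by blast
  have "lagrangian_objective q yh \<eta>h (y, x, \<eta>) \<le> lagrangian_objective q yh \<eta>h z'" if "z' \<in> ?F" for z'
  proof -
    obtain y' x' \<eta>' where z': "z' = (y', x', \<eta>')" by (metis prod.exhaust)
    then have "(y', \<eta>') \<in> S" using that S by blast
    from z(2)[OF this] show ?thesis by (simp add: z' lagrangian_objective_def)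
  qed
  then show ?thesis using x by blast
qed

section \<open>Strong duality with a nonzero denominator\<close>

lemma deep_cut_exists:
  fixes A :: "real^'k^'m" and B :: "real^'n^'m"
  assumes pq: "1 \<le> p" "1 \<le> q" "1 / p + 1 / q = 1"
    and feas: "lagrangian_feasible A B b c f \<eta>h \<noteq> {}" and d: "0 < d"
    and dist: "\<And>z. z \<in> lagrangian_feasible A B b c f \<eta>h \<Longrightarrow> d \<le> lagrangian_objective q yh \<eta>h z"
  shows "\<exists>s\<in>dual_cone A c. cut_norm p B f s \<noteq> 0 \<and> ereal d \<le> cut_depth p B b f yh \<eta>h s"
proof -
  define Q where "Q = {(y, \<eta>). \<exists>x. c \<bullet> x + f \<bullet> y \<le> \<eta> \<and> b - B *v y \<le> A *v x \<and> 0 \<le> x}"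
  obtain y0 x0 \<eta>0 where z0: "c \<bullet> x0 + f \<bullet> y0 \<le> \<eta>0" "b - B *v y0 \<le> A *v x0" "0 \<le> x0"
    using feas by (auto simp: lagrangian_feasible_def)
  have "d \<le> lp_norm q (z - (yh, \<eta>h))" if "z \<in> Q" for z
  proof -
    obtain y \<eta> where z: "z = (y, \<eta>)" by fastforce
    with that obtain x where "c \<bullet> x + f \<bullet> y \<le> \<eta>" "b - B *v y \<le> A *v x" "0 \<le> x"
      by (auto simp: Q_def)
    \<comment> \<open>Raising \<open>\<eta>\<close> to at least \<open>\<eta>h\<close> replaces
      \<open>\<eta> - \<eta>h\<close> by its positive part, so the distance bound carries over to
      all of \<open>Q\<close>.\<close>
    then have "(y, x, max \<eta> \<eta>h) \<in> lagrangian_feasible A B b c f \<eta>h"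
      by (auto simp: lagrangian_feasible_def)
    then have "d \<le> lp_norm q (y - yh, max \<eta> \<eta>h - \<eta>h)"
      using dist by (fastforce simp: lagrangian_objective_def)
    also have "\<dots> \<le> lp_norm q (z - (yh, \<eta>h))"
      using pq by (intro lp_norm_mono) (auto simp: z Basis_prod_def)
    finally show ?thesis .
  qed
  moreover have "convex Q"
    unfolding Q_def by (rule closed_convex_projection)
  moreover have "Q \<noteq> {}"
    using z0 by (auto simp: Q_def)
  ultimately obtain a where a: "a \<noteq> 0"
    "\<And>z. z \<in> Q \<Longrightarrow> a \<bullet> (yh, \<eta>h) + d * lp_norm p a \<le> a \<bullet> z"
    using lp_norm_separation[OF pq, of Q d "(yh, \<eta>h)"] d by blast
  obtain g \<gamma> where a_eq: "a = (g, \<gamma>)" by fastforce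
  \<comment> \<open>This is the lower bound for the separating functional on \<open>Q\<close>; its
    excess over the value at the incumbent will be the violation guaranteed for the cut.\<close>
  define \<alpha> where "\<alpha> = g \<bullet> yh + \<gamma> * \<eta>h + d * lp_norm p a"
  have "\<exists>\<pi>. (\<pi>, \<gamma>) \<in> dual_cone A c \<and> \<pi> v* B - \<gamma> *\<^sub>R f = g \<and> \<alpha> \<le> \<pi> \<bullet> b"
  proof (rule dual_certificate[OF z0])
    fix y :: "real^'n" and x :: "real^'k" and \<eta> :: real
    assume "c \<bullet> x + f \<bullet> y \<le> \<eta>" "b - B *v y \<le> A *v x" "0 \<le> x"
    then have "(y, \<eta>) \<in> Q" by (auto simp: Q_def)
    from a(2)[OF this] show "\<alpha> \<le> g \<bullet> y + \<gamma> * \<eta>" by (simp add: a_eq \<alpha>_def)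
  qed
  then obtain \<pi> where \<pi>: "(\<pi>, \<gamma>) \<in> dual_cone A c" "\<pi> v* B - \<gamma> *\<^sub>R f = g" "\<alpha> \<le> \<pi> \<bullet> b"
    by blast
  have norm: "cut_norm p B f (\<pi>, \<gamma>) = lp_norm p a"
    by (simp add: cut_norm_def \<pi>(2) a_eq)
  have pos: "0 < lp_norm p a"
    using a(1) pq by (simp add: less_le)
  have "d * lp_norm p a \<le> cut_violation B b f yh \<eta>h (\<pi>, \<gamma>)"
    using \<pi>(3) by (simp add: cut_violation_def \<alpha>_def inner_diff_right inner_diff_left algebra_simps
      dot_lmul_matrix flip: \<pi>(2))
  then have "ereal d \<le> cut_depth p B b f yh \<eta>h (\<pi>, \<gamma>)"
    using pos by (simp add: cut_depth_def norm pos_le_divide_eq)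
  then show ?thesis
    using \<pi>(1) norm pos by (intro bexI[of _ "(\<pi>, \<gamma>)"]) auto
qed

text \<open>Equivalence is expressed by equal optimal values together with attainment on both sides.
  A nonzero denominator is asserted when the problem is feasible but the incumbent is not: a
  feasible incumbent gives the value 0, attained at the origin as \<open>0 / 0\<close>, and an
  infeasible problem gives the value \<open>\<infinity>\<close>, which no quotient with nonzero
  denominator reaches.\<close>

theorem theorem1:
  fixes A :: "real^'k^'m" and B :: "real^'n^'m"
    and b :: "real^'m" and c :: "real^'k" and f :: "real^'n" and Y :: "(real^'n) set"
    and p q :: ereal and yh :: "real^'n" and \<eta>h :: real
  assumes "bounded_milp A B b c f Y"
    and "1 \<le> p" and "1 \<le> q" and "1 / p + 1 / q = 1"
  shows "separation_value p A B b c f yh \<eta>h = lagrangian_value q A B b c f yh \<eta>h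
    \<and> (\<exists>s\<in>dual_cone A c. cut_depth p B b f yh \<eta>h s = separation_value p A B b c f yh \<eta>h)
    \<and> (lagrangian_feasible A B b c f \<eta>h \<noteq> {} \<longrightarrow>
        (\<exists>z\<in>lagrangian_feasible A B b c f \<eta>h.
          ereal (lagrangian_objective q yh \<eta>h z) = lagrangian_value q A B b c f yh \<eta>h))
    \<and> (lagrangian_feasible A B b c f \<eta>h \<noteq> {} \<and>
       (\<forall>x. (yh, x, \<eta>h) \<notin> lagrangian_feasible A B b c f \<eta>h) \<longrightarrow>
        (\<exists>s\<in>dual_cone A c. cut_norm p B f s \<noteq> 0 \<and>
          cut_depth p B b f yh \<eta>h s = separation_value p A B b c f yh \<eta>h))"
proof -
  note pq = assms(2-4)
  let ?F = "lagrangian_feasible A B b c f \<eta>h"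
  let ?sep = "separation_value p A B b c f yh \<eta>h"
  let ?lag = "lagrangian_value q A B b c f yh \<eta>h"
  have sep_ge: "cut_depth p B b f yh \<eta>h s \<le> ?sep" if "s \<in> dual_cone A c" for s
    unfolding separation_value_def using that by (rule SUP_upper)
  have sep_le: "?sep \<le> ?lag"
    unfolding separation_value_def lagrangian_value_def
    using cut_depth_le_objective[OF pq] by (intro SUP_least INF_greatest) auto
  show ?thesis
  proof (cases "?F = {}")
    case True
    then have lag: "?lag = \<infinity>" by (simp add: lagrangian_value_def top_ereal_def)
    obtain s where s: "s \<in> dual_cone A c" "cut_depth p B b f yh \<eta>h s = \<infinity>"
      using infeasible_dual_certificate[OF True] by blast
    then have "?sep = \<infinity>" using sep_ge[OF s(1)] by simp
    then show ?thesis using True lag s by auto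
  next
    case False
    obtain z where z: "z \<in> ?F"
      "\<And>z'. z' \<in> ?F \<Longrightarrow> lagrangian_objective q yh \<eta>h z \<le> lagrangian_objective q yh \<eta>h z'"
      using lagrangian_minimum_attained[OF pq(2) False] by blast
    define d where "d = lagrangian_objective q yh \<eta>h z"
    have lag: "?lag = ereal d"
      unfolding lagrangian_value_def d_def using z by (intro antisym INF_lower INF_greatest) auto
    show ?thesis
    proof (cases "d = 0")
      \<comment> \<open>Here the incumbent itself is feasible, which refutes the premise of the last
        conjunct, and the origin of the dual cone attains the value 0.\<close>
      case True
      have zero: "0 \<in> dual_cone A c" "cut_depth p B b f yh \<eta>h 0 = 0"
        by (auto simp: dual_cone_def zero_prod_def cut_depth_def cut_violation_def)
      then have "?sep = 0" using sep_ge[of 0] sep_le lag True by (simp add: zero_ereal_def)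
      moreover have "\<exists>x. (yh, x, \<eta>h) \<in> ?F"
      proof -
        obtain y x \<eta> where z_eq: "z = (y, x, \<eta>)" by (metis prod.exhaust)
        have "(y - yh, \<eta> - \<eta>h) = 0"
          using True pq by (simp add: d_def z_eq lagrangian_objective_def)
        then show ?thesis using z(1) z_eq by (auto simp: zero_prod_def)
      qed
      ultimately show ?thesis
        using zero lag True z(1) unfolding d_def zero_ereal_def by metis
    next
      \<comment> \<open>The cut of depth at least \<open>d\<close> is squeezed by weak duality, so
        it attains the common value.\<close>
      case d: False
      have "0 \<le> d" by (auto simp: d_def lagrangian_objective_def split: prod.split)
      then obtain s where s: "s \<in> dual_cone A c" "cut_norm p B f s \<noteq> 0"
        "ereal d \<le> cut_depth p B b f yh \<eta>h s"
        using deep_cut_exists[OF pq False, of d] d z(2) by (force simp: d_def)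
      then have "?sep = ereal d" "cut_depth p B b f yh \<eta>h s = ereal d"
        using sep_ge[OF s(1)] sep_le lag by auto
      then show ?thesis using s lag z(1) unfolding d_def by auto
    qed
  qed
qed

end
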